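(* Let $n>k\ge 1$ be integers, let $\boldsymbol{X}\in\mathbb{R}^{n\times k}$ have rank $k$, let $\boldsymbol{K}\in\mathbb{R}^{k\times k}$ be symmetric positive semidefinite, and let $\boldsymbol{W}\in\mathbb{R}^{n\times n}$ be a row-standardized spatial weights matrix. Suppose that $\mathcal{C}((\boldsymbol{W}+\boldsymbol{W}^\top)\boldsymbol{X})\subseteq\mathcal{C}(\boldsymbol{X})$ and $\mathcal{C}(\boldsymbol{W}\boldsymbol{W}^\top\boldsymbol{X})\subseteq\mathcal{C}(\boldsymbol{X})$. Define $$\boldsymbol{R}_1=(\boldsymbol{X}^\top\boldsymbol{X})^{-1}\boldsymbol{X}^\top(\boldsymbol{W}+\boldsymbol{W}^\top)\boldsymbol{X},\qquad \boldsymbol{R}_2=(\boldsymbol{X}^\top\boldsymbol{X})^{-1}\boldsymbol{X}^\top\boldsymbol{W}\boldsymbol{W}^\top\boldsymbol{X},$$ $$\boldsymbol{R}=(\boldsymbol{R}_1:\boldsymbol{R}_2)\in\mathbb{R}^{k\times 2k},\qquad q=k-\mathrm{rank}(\boldsymbol{R}),$$ and let $\boldsymbol{Q}\in\mathbb{R}^{k\times q}$ be a matrix whose columns form an orthonormal basis for $\mathcal{N}(\boldsymbol{R}^\top)$. Then the condition $$\mathcal{C}\begin{pmatrix}(\boldsymbol{W}+\boldsymbol{W}^\top)\boldsymbol{X}\\ \boldsymbol{0}\end{pmatrix}\subseteq\mathcal{C}\begin{pmatrix}\boldsymbol{X}\\ \boldsymbol{K}\end{pmatrix}\quad\text{and}\quad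 \mathcal{C}\begin{pmatrix}\boldsymbol{W}\boldsymbol{W}^\top\boldsymbol{X}\\ \boldsymbol{0}\end{pmatrix}\subseteq\mathcal{C}\begin{pmatrix}\boldsymbol{X}\\ \boldsymbol{K}\end{pmatrix}$$ holds if and only if $\boldsymbol{K}=\boldsymbol{Q}\boldsymbol{H}\boldsymbol{Q}^\top$ for some symmetric positive semidefinite $\boldsymbol{H}\in\mathbb{R}^{q\times q}$.
   Context: $\mathcal{C}(\boldsymbol{A})$ and $\mathcal{N}(\boldsymbol{A})$ denote the column space and null space of a real matrix $\boldsymbol{A}$; $(\boldsymbol{R}_1:\boldsymbol{R}_2)$ denotes horizontal concatenation; the zero block $\boldsymbol{0}$ in the stacked matrices is $k\times k$. A row-standardized spatial weights matrix is a matrix $\boldsymbol{W}=(w_{ij})\in\mathbb{R}^{n\times n}$ (not necessarily symmetric) with $w_{ij}\ge 0$ and $\sum_{j=1}^n w_{ij}=1$ for every $i$. When $q=0$, $\boldsymbol{Q}$ has no columns and $\boldsymbol{Q}\boldsymbol{H}\boldsymbol{Q}^\top$ is understood as the $k\times k$ zero matrix. *)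

theory Defs
  imports
    Complex_Main
    "Jordan_Normal_Form.Matrix_Kernel"
    "Jordan_Normal_Form.DL_Rank"
    "Jordan_Normal_Form.Gauss_Jordan_Elimination"
begin

definition append_cols :: "'a :: zero mat \<Rightarrow> 'a mat \<Rightarrow> 'a mat" (infixr \<open>@\<^sub>c\<close> 65) where
  "A @\<^sub>c B = four_block_mat A B (0\<^sub>m 0 (dim_col A)) (0\<^sub>m 0 (dim_col B))"

definition sym_psd_mat :: "nat \<Rightarrow> real mat \<Rightarrow> bool" where
  "sym_psd_mat m A \<longleftrightarrow>
     A \<in> carrier_mat m m \<and> A\<^sup>T = A \<and> (\<forall>v \<in> carrier_vec m. 0 \<le> v \<bullet> (A *\<^sub>v v))"

definition row_standardized :: "nat \<Rightarrow> real mat \<Rightarrow> bool" where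
  "row_standardized n W \<longleftrightarrow>
     W \<in> carrier_mat n n \<and>
     (\<forall>i<n. \<forall>j<n. 0 \<le> W $$ (i, j)) \<and>
     (\<forall>i<n. (\<Sum>j<n. W $$ (i, j)) = 1)"

(* Orthonormality forces the columns of Q to be distinct, so passing to the set of columns
   loses nothing; kernel.basis m A is the predicate "is a basis of the null space of A", for
   a matrix A with m columns. With q = 0 it says that this null space is trivial. *)
definition orthonormal_kernel_basis :: "nat \<Rightarrow> nat \<Rightarrow> real mat \<Rightarrow> real mat \<Rightarrow> bool" where
  "orthonormal_kernel_basis m q A Q \<longleftrightarrow>
     Q \<in> carrier_mat m q \<and>
     (\<forall>i<q. \<forall>j<q. col Q i \<bullet> col Q j = (if i = j then 1 else 0)) \<and>
     kernel.basis m A (set (cols Q))"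

end

theory Submission
  imports Defs
begin

text \<open>
  Both conditions say \<open>R\<^sup>T * K = 0\<close>, once through the stacked column spaces and once through \<open>Q\<close>.

  Let \<open>S\<close> be either of \<open>W + W\<^sup>T\<close> and \<open>W * W\<^sup>T\<close>. Since \<open>X\<close> has full column rank,
  \<open>L = (X\<^sup>T * X)\<^sup>-\<^sup>1 * X\<^sup>T\<close> is a left inverse of \<open>X\<close>, and since the column space of \<open>S * X\<close> lies
  in that of \<open>X\<close>, this gives \<open>S * X = X * M\<close> with \<open>M = L * S * X\<close>, which is the corresponding block
  of \<open>R\<close>. The stacked inclusion asks for a coefficient matrix \<open>N\<close> with \<open>X * M = X * N\<close> and
  \<open>K * N = 0\<close>. The first equation forces \<open>N = M\<close>, so the inclusion just says \<open>K * M = 0\<close>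
  (\<open>stacked_col_space_subset_iff\<close>), that is, \<open>M\<^sup>T * K = 0\<close> because \<open>K\<close> is symmetric. The two
  inclusions together say \<open>R\<^sup>T * K = 0\<close>.

  On the other side, \<open>R\<^sup>T * K = 0\<close> puts the columns of \<open>K\<close> into the null space of \<open>R\<^sup>T\<close>, onto
  which \<open>Q * Q\<^sup>T\<close> projects orthogonally, so it says \<open>K = Q * Q\<^sup>T * K\<close>. Transposing,
  \<open>K = K * Q * Q\<^sup>T\<close> as well, whence \<open>K = Q * H * Q\<^sup>T\<close> with \<open>H = Q\<^sup>T * K * Q\<close>, which inherits
  symmetry and semidefiniteness from \<open>K\<close>; conversely \<open>R\<^sup>T * Q = 0\<close> makes every \<open>Q * H * Q\<^sup>T\<close> a
  solution (\<open>sym_psd_kernel_iff_compression\<close>).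
\<close>

section \<open>Column spaces and stacked matrices\<close>

lemma col_in_col_space:
  fixes B :: "'a :: field mat"
  assumes B: "B \<in> carrier_mat n p" and j: "j < p"
  shows "col B j \<in> vec_space.col_space n B"
proof -
  have "B *\<^sub>v unit_vec p j = col B j"
    using B j by (intro eq_vecI) auto
  then show ?thesis
    using B j unfolding vec_space.col_space_eq[OF B] by auto
qed

lemma col_space_subset_iff_factor:
  fixes A B :: "'a :: field mat"
  assumes A: "A \<in> carrier_mat n k" and B: "B \<in> carrier_mat n p"
  shows "vec_space.col_space n B \<subseteq> vec_space.col_space n A
         \<longleftrightarrow> (\<exists>M \<in> carrier_mat k p. B = A * M)"
proof
  assume sub: "vec_space.col_space n B \<subseteq> vec_space.col_space n A"
  have "\<exists>u \<in> carrier_vec k. A *\<^sub>v u = col B j" if "j < p" for j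
  proof -
    have "col B j \<in> vec_space.col_space n B"
      by (rule col_in_col_space[OF B that])
    then show ?thesis
      using sub A unfolding vec_space.col_space_eq[OF A] by auto
  qed
  then obtain u where u: "\<And>j. j < p \<Longrightarrow> u j \<in> carrier_vec k \<and> A *\<^sub>v u j = col B j"
    by metis
  define M where "M = mat_of_cols k (map u [0..<p])"
  have M: "M \<in> carrier_mat k p"
    unfolding M_def by auto
  have "col (A * M) j = col B j" if "j < p" for j
  proof -
    have "col M j = u j"
      unfolding M_def using u that by (subst col_mat_of_cols) auto
    then show ?thesis
      using col_mult2[OF A M that] u[OF that] by simp
  qed
  then have "B = A * M"
    using A B M by (intro mat_col_eqI) auto
  with M show "\<exists>M \<in> carrier_mat k p. B = A * M" ..
next
  assume "\<exists>M \<in> carrier_mat k p. B = A * M"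
  then obtain M where M: "M \<in> carrier_mat k p" and BAM: "B = A * M" ..
  show "vec_space.col_space n B \<subseteq> vec_space.col_space n A"
  proof
    fix y
    assume "y \<in> vec_space.col_space n B"
    then obtain x where x: "x \<in> carrier_vec p" and y: "B *\<^sub>v x = y"
      unfolding vec_space.col_space_eq[OF B] using B by auto
    have "A *\<^sub>v (M *\<^sub>v x) = y"
      using y assoc_mult_mat_vec[OF A M x] BAM by simp
    then show "y \<in> vec_space.col_space n A"
      using A M x unfolding vec_space.col_space_eq[OF A] by auto
  qed
qed

lemma append_rows_mult:
  fixes A B M :: "'a :: comm_ring_1 mat"
  assumes "A \<in> carrier_mat nr1 n" "B \<in> carrier_mat nr2 n" "M \<in> carrier_mat n nc"
  shows "(A @\<^sub>r B) * M = A * M @\<^sub>r B * M"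
  using assms by (intro eq_matI) (auto simp: append_rows_def scalar_prod_def)

lemma append_rows_eq_iff:
  assumes "A \<in> carrier_mat nr1 nc" "A' \<in> carrier_mat nr1 nc"
    and "B \<in> carrier_mat nr2 nc" "B' \<in> carrier_mat nr2 nc"
  shows "A @\<^sub>r B = A' @\<^sub>r B' \<longleftrightarrow> A = A' \<and> B = B'"
proof
  assume eq: "A @\<^sub>r B = A' @\<^sub>r B'"
  have "A $$ (i, j) = A' $$ (i, j)" if "i < nr1" "j < nc" for i j
    using arg_cong[OF eq, of "\<lambda>M. M $$ (i, j)"] that assms by (auto simp: append_rows_def)
  moreover have "B $$ (i, j) = B' $$ (i, j)" if "i < nr2" "j < nc" for i j
    using arg_cong[OF eq, of "\<lambda>M. M $$ (nr1 + i, j)"] that assms by (auto simp: append_rows_def)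
  ultimately show "A = A' \<and> B = B'"
    using assms by (auto intro!: eq_matI)
qed simp

lemma transpose_append_cols:
  assumes "A \<in> carrier_mat nr nc1" "B \<in> carrier_mat nr nc2"
  shows "(A @\<^sub>c B)\<^sup>T = A\<^sup>T @\<^sub>r B\<^sup>T"
  using assms unfolding append_cols_def append_rows_def
  by (subst transpose_four_block_mat) (auto intro!: arg_cong2[of _ _ _ _ "\<lambda>C D. four_block_mat _ C _ D"])

section \<open>Full column rank and left inverses\<close>

text \<open>
  A repeated column leaves a spanning set of fewer than \<open>nc\<close> vectors. Distinctness matters because
  independence is a property of the set of columns, in which a repetition would go unnoticed.
\<close>

lemma (in vec_space) full_rank_distinct_cols:
  assumes A: "A \<in> carrier_mat n nc" and "rank A = nc"
  shows "distinct (cols A)"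
proof -
  obtain S where S: "maximal S (\<lambda>T. T \<subseteq> set (cols A) \<and> lin_indpt T)"
    using maximal_exists_superset[of "set (cols A)" "\<lambda>T. T \<subseteq> set (cols A) \<and> lin_indpt T" "{}"]
    by (auto simp: lin_dep_def)
  then have "S \<subseteq> set (cols A)"
    by (simp add: maximal_def)
  then have "nc \<le> card (set (cols A))"
    using rank_card_indpt[OF A S] \<open>rank A = nc\<close> card_mono[of "set (cols A)" S] by simp
  then have "card (set (cols A)) = length (cols A)"
    using card_length[of "cols A"] A by simp
  then show ?thesis
    by (rule card_distinct)
qed

text \<open>
  The Gram matrix is nonsingular because \<open>X\<^sup>T * X * v = 0\<close> makes the squared length of \<open>X * v\<close> vanish,
  and a matrix of full column rank kills only the zero vector.
\<close>

lemma full_rank_left_inverse: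
  fixes X :: "real mat"
  assumes X: "X \<in> carrier_mat n k" and "vec_space.rank n X = k"
  defines "L \<equiv> the (mat_inverse (X\<^sup>T * X)) * X\<^sup>T"
  shows "L \<in> carrier_mat k n" and "L * X = 1\<^sub>m k"
proof -
  interpret vec_space "TYPE(real)" n .
  have G: "X\<^sup>T * X \<in> carrier_mat k k" and Xt: "X\<^sup>T \<in> carrier_mat k n"
    using X by auto
  have dist: "distinct (cols X)" and indpt: "lin_indpt (set (cols X))"
    using full_rank_distinct_cols full_rank_lin_indpt assms by auto
  have "v = 0\<^sub>v k" if v: "v \<in> carrier_vec k" and Gv: "(X\<^sup>T * X) *\<^sub>v v = 0\<^sub>v k" for v
  proof -
    have Xv: "X *\<^sub>v v \<in> carrier_vec n"
      using X v by auto
    have "(X *\<^sub>v v) \<bullet> (X *\<^sub>v v) = (X\<^sup>T *\<^sub>v (X *\<^sub>v v)) \<bullet> v"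
      using transpose_vec_mult_scalar[OF X v Xv] by simp
    also have "\<dots> = 0"
      using Gv assoc_mult_mat_vec[OF Xt X v] v by simp
    finally have "X *\<^sub>v v = 0\<^sub>v n"
      using conjugate_square_eq_0_vec[OF Xv] by (simp add: vec_conjugate_real)
    then show ?thesis
      using lin_depI[OF X v _ _ dist] indpt by blast
  qed
  then have "det (X\<^sup>T * X) \<noteq> 0"
    using det_0_iff_vec_prod_zero_field[OF G] by blast
  then have "mat_inverse (X\<^sup>T * X) \<noteq> None"
    using det_non_zero_imp_unit[OF G, of "()"] mat_inverse(1)[OF G, of "()"] by blast
  then obtain B where B: "mat_inverse (X\<^sup>T * X) = Some B"
    by blast
  have inv: "B * (X\<^sup>T * X) = 1\<^sub>m k" "B \<in> carrier_mat k k"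
    using mat_inverse(2)[OF G B] by auto
  show "L \<in> carrier_mat k n"
    using inv Xt by (simp add: L_def B)
  show "L * X = 1\<^sub>m k"
    using inv X by (simp add: L_def B assoc_mult_mat[OF _ Xt X])
qed

text \<open>
  Inclusion of column spaces yields some factorisation \<open>Y = X * M\<close>; a left inverse of \<open>X\<close>
  identifies \<open>M\<close> as \<open>L * Y\<close>.
\<close>

lemma factor_eq_left_inverse_mult:
  fixes X Y L :: "'a :: field mat"
  assumes X: "X \<in> carrier_mat n k" and Y: "Y \<in> carrier_mat n p"
    and L: "L \<in> carrier_mat k n" and LX: "L * X = 1\<^sub>m k"
    and sub: "vec_space.col_space n Y \<subseteq> vec_space.col_space n X"
  shows "Y = X * (L * Y)"
proof -
  obtain M where M: "M \<in> carrier_mat k p" and Y_eq: "Y = X * M"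
    using sub unfolding col_space_subset_iff_factor[OF X Y] by blast
  have "L * Y = M"
    using M LX by (simp add: Y_eq assoc_mult_mat[OF L X M, symmetric])
  then show ?thesis
    using Y_eq by simp
qed

text \<open>
  The upper block determines the coefficients: multiplying \<open>X * M = X * N\<close> by \<open>L\<close> gives \<open>M = N\<close>,
  so \<open>M\<close> is the only matrix that could also produce the zero block.
\<close>

lemma stacked_col_space_subset_iff:
  fixes X K M L :: "'a :: field mat"
  assumes X: "X \<in> carrier_mat n k" and K: "K \<in> carrier_mat m k" and M: "M \<in> carrier_mat k p"
    and L: "L \<in> carrier_mat k n" and LX: "L * X = 1\<^sub>m k"
  shows "vec_space.col_space (n + m) (X * M @\<^sub>r 0\<^sub>m m p) \<subseteq> vec_space.col_space (n + m) (X @\<^sub>r K)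
         \<longleftrightarrow> K * M = 0\<^sub>m m p"
proof -
  have XK: "X @\<^sub>r K \<in> carrier_mat (n + m) k"
    and XM0: "X * M @\<^sub>r 0\<^sub>m m p \<in> carrier_mat (n + m) p"
    using X K M by auto
  have "X * M @\<^sub>r 0\<^sub>m m p = (X @\<^sub>r K) * N \<longleftrightarrow> N = M \<and> K * N = 0\<^sub>m m p"
    if N: "N \<in> carrier_mat k p" for N
  proof -
    have "X * M = X * N \<longleftrightarrow> N = M"
      using M N LX assoc_mult_mat[OF L X M] assoc_mult_mat[OF L X N] by auto
    moreover have "X * M @\<^sub>r 0\<^sub>m m p = X * N @\<^sub>r K * N \<longleftrightarrow> X * M = X * N \<and> 0\<^sub>m m p = K * N"
      using X K M N by (intro append_rows_eq_iff) auto
    ultimately show ?thesis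
      by (auto simp: append_rows_mult[OF X K N])
  qed
  then show ?thesis
    using M unfolding col_space_subset_iff_factor[OF XK XM0] by blast
qed

section \<open>Orthonormal bases of a null space\<close>

lemma mult_eq_0_iff_col_space_subset_kernel:
  fixes A B :: "'a :: field mat"
  assumes A: "A \<in> carrier_mat p m" and B: "B \<in> carrier_mat m r"
  shows "A * B = 0\<^sub>m p r \<longleftrightarrow> vec_space.col_space m B \<subseteq> mat_kernel A"
proof
  assume 0: "A * B = 0\<^sub>m p r"
  show "vec_space.col_space m B \<subseteq> mat_kernel A"
  proof
    fix y
    assume "y \<in> vec_space.col_space m B"
    then obtain x where x: "x \<in> carrier_vec r" and y: "y = B *\<^sub>v x"
      unfolding vec_space.col_space_eq[OF B] using B by auto
    have "A *\<^sub>v y = 0\<^sub>m p r *\<^sub>v x"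
      using assoc_mult_mat_vec[OF A B x] 0 y by simp
    then show "y \<in> mat_kernel A"
      using A B x y by (intro mat_kernelI[OF A]) (auto intro!: eq_vecI)
  qed
next
  assume sub: "vec_space.col_space m B \<subseteq> mat_kernel A"
  have "col (A * B) j = 0\<^sub>v p" if "j < r" for j
  proof -
    have "col B j \<in> mat_kernel A"
      using sub col_in_col_space[OF B that] by blast
    then show ?thesis
      using mat_kernelD[OF A] col_mult2[OF A B that] by simp
  qed
  then show "A * B = 0\<^sub>m p r"
    using A B by (intro mat_col_eqI) auto
qed

lemma orthonormal_kernel_basis_col_space:
  assumes A: "A \<in> carrier_mat p m" and Q: "orthonormal_kernel_basis m q A Q"
  shows "vec_space.col_space m Q = mat_kernel A"
proof -
  interpret kernel p m A
    by standard (rule A)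
  have "basis (set (cols Q))"
    using Q by (simp add: orthonormal_kernel_basis_def)
  then have "set (cols Q) \<subseteq> mat_kernel A" and "span (set (cols Q)) = mat_kernel A"
    by (auto simp: Ker.basis_def)
  then show ?thesis
    using span_same by (simp add: NC.col_space_def)
qed

lemma orthonormal_kernel_basis_gram:
  assumes "orthonormal_kernel_basis m q A Q"
  shows "Q\<^sup>T * Q = 1\<^sub>m q"
  using assms by (intro eq_matI) (auto simp: orthonormal_kernel_basis_def)

text \<open>
  Orthonormality makes \<open>Q\<^sup>T\<close> a left inverse of \<open>Q\<close>, so a matrix with columns in the null space,
  which is the column space of \<open>Q\<close>, has coefficients \<open>Q\<^sup>T * B\<close> with respect to \<open>Q\<close>. In other
  words, the orthogonal projector \<open>Q * Q\<^sup>T\<close> fixes it.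
\<close>

lemma kernel_iff_projector_fixes:
  assumes A: "A \<in> carrier_mat p m" and Q: "orthonormal_kernel_basis m q A Q"
    and B: "B \<in> carrier_mat m r"
  shows "A * B = 0\<^sub>m p r \<longleftrightarrow> B = Q * (Q\<^sup>T * B)"
proof -
  have Qc: "Q \<in> carrier_mat m q"
    using Q by (simp add: orthonormal_kernel_basis_def)
  then have Qt: "Q\<^sup>T \<in> carrier_mat q m"
    by simp
  have "A * B = 0\<^sub>m p r \<longleftrightarrow> vec_space.col_space m B \<subseteq> mat_kernel A"
    by (rule mult_eq_0_iff_col_space_subset_kernel[OF A B])
  then have "A * B = 0\<^sub>m p r \<longleftrightarrow> (\<exists>M \<in> carrier_mat q r. B = Q * M)"
    using col_space_subset_iff_factor[OF Qc B] orthonormal_kernel_basis_col_space[OF A Q] by simp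
  also have "\<dots> \<longleftrightarrow> B = Q * (Q\<^sup>T * B)"
  proof
    assume "\<exists>M \<in> carrier_mat q r. B = Q * M"
    then have "vec_space.col_space m B \<subseteq> vec_space.col_space m Q"
      using col_space_subset_iff_factor[OF Qc B] by simp
    then show "B = Q * (Q\<^sup>T * B)"
      by (rule factor_eq_left_inverse_mult[OF Qc B Qt orthonormal_kernel_basis_gram[OF Q]])
  qed (use Qt B in auto)
  finally show ?thesis .
qed

text \<open>
  A symmetric \<open>K\<close> whose columns the projector \<open>Q * Q\<^sup>T\<close> fixes has its rows fixed as well, so the
  compression \<open>H = Q\<^sup>T * K * Q\<close> recovers it. The quadratic form of \<open>H\<close> at \<open>v\<close> is that of \<open>K\<close> at
  \<open>Q * v\<close>, so \<open>H\<close> is again positive semidefinite.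
\<close>

lemma sym_psd_kernel_iff_compression:
  assumes A: "A \<in> carrier_mat p m" and Q: "orthonormal_kernel_basis m q A Q"
    and K: "sym_psd_mat m K"
  shows "A * K = 0\<^sub>m p m \<longleftrightarrow> (\<exists>H. sym_psd_mat q H \<and> K = Q * H * Q\<^sup>T)"
proof
  have Qc: "Q \<in> carrier_mat m q"
    using Q by (simp add: orthonormal_kernel_basis_def)
  then have Qt: "Q\<^sup>T \<in> carrier_mat q m"
    by simp
  have Kc: "K \<in> carrier_mat m m" and Ksym: "K\<^sup>T = K"
    and Kpsd: "\<And>v. v \<in> carrier_vec m \<Longrightarrow> 0 \<le> v \<bullet> (K *\<^sub>v v)"
    using K by (auto simp: sym_psd_mat_def)
  {
    define H where "H = Q\<^sup>T * (K * Q)"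
    have KQ: "K * Q \<in> carrier_mat m q" and QtK: "Q\<^sup>T * K \<in> carrier_mat q m"
      using Kc Qc by auto
    have H: "H \<in> carrier_mat q q"
      unfolding H_def using Qt KQ by auto
    assume "A * K = 0\<^sub>m p m"
    then have fix_cols: "K = Q * (Q\<^sup>T * K)"
      using kernel_iff_projector_fixes[OF A Q Kc] by simp
    have "K = (Q * (Q\<^sup>T * K))\<^sup>T"
      using fix_cols Ksym by simp
    also have "\<dots> = K * Q * Q\<^sup>T"
      using transpose_mult[OF Qc QtK] transpose_mult[OF Qt Kc] Ksym by simp
    finally have fix_rows: "K = K * Q * Q\<^sup>T" .
    have "Q * H * Q\<^sup>T = Q * (Q\<^sup>T * K) * Q * Q\<^sup>T"
      using assoc_mult_mat[OF Qt Kc Qc] assoc_mult_mat[OF Qc QtK Qc] by (simp add: H_def)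
    then have "K = Q * H * Q\<^sup>T"
      using fix_cols fix_rows by simp
    moreover have "H\<^sup>T = H"
      unfolding H_def using transpose_mult[OF Qt KQ] transpose_mult[OF Kc Qc] Ksym
        assoc_mult_mat[OF Qt Kc Qc] by simp
    moreover have "0 \<le> v \<bullet> (H *\<^sub>v v)" if v: "v \<in> carrier_vec q" for v
    proof -
      have Qv: "Q *\<^sub>v v \<in> carrier_vec m"
        using Qc v by auto
      have "v \<bullet> (H *\<^sub>v v) = v \<bullet> (Q\<^sup>T *\<^sub>v (K *\<^sub>v (Q *\<^sub>v v)))"
        unfolding H_def using assoc_mult_mat_vec[OF Qt KQ v] assoc_mult_mat_vec[OF Kc Qc v] by simp
      also have "\<dots> = (Q *\<^sub>v v) \<bullet> (K *\<^sub>v (Q *\<^sub>v v))"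
        using transpose_vec_mult_scalar[OF Qt _ v, of "K *\<^sub>v (Q *\<^sub>v v)"] Kc Qv by simp
      finally show ?thesis
        using Kpsd[OF Qv] by simp
    qed
    ultimately show "\<exists>H. sym_psd_mat q H \<and> K = Q * H * Q\<^sup>T"
      using H by (auto simp: sym_psd_mat_def)
  next
    assume "\<exists>H. sym_psd_mat q H \<and> K = Q * H * Q\<^sup>T"
    then obtain H where H: "H \<in> carrier_mat q q" and K_eq: "K = Q * H * Q\<^sup>T"
      by (auto simp: sym_psd_mat_def)
    have HQt: "H * Q\<^sup>T \<in> carrier_mat q m"
      using H Qt by auto
    have factor: "K = Q * (H * Q\<^sup>T)"
      using K_eq assoc_mult_mat[OF Qc H Qt] by (rule trans)
    have "Q\<^sup>T * K = Q\<^sup>T * Q * (H * Q\<^sup>T)"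
      unfolding factor by (rule assoc_mult_mat[OF Qt Qc HQt, symmetric])
    also have "\<dots> = H * Q\<^sup>T"
      unfolding orthonormal_kernel_basis_gram[OF Q] by (rule left_mult_one_mat[OF HQt])
    finally have "K = Q * (Q\<^sup>T * K)"
      by (simp only: factor[symmetric])
    then show "A * K = 0\<^sub>m p m"
      using kernel_iff_projector_fixes[OF A Q Kc] by simp
  }
qed

section \<open>The equivalence\<close>

theorem corollary3p4:
  fixes n k q :: nat
    and X K W R\<^sub>1 R\<^sub>2 R Q :: "real mat"
  assumes "1 \<le> k" and "k < n"
    and "X \<in> carrier_mat n k" and "vec_space.rank n X = k"
    and "sym_psd_mat k K"
    and "row_standardized n W"
    and "vec_space.col_space n ((W + W\<^sup>T) * X) \<subseteq> vec_space.col_space n X"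
    and "vec_space.col_space n (W * W\<^sup>T * X) \<subseteq> vec_space.col_space n X"
    and "R\<^sub>1 = the (mat_inverse (X\<^sup>T * X)) * X\<^sup>T * (W + W\<^sup>T) * X"
    and "R\<^sub>2 = the (mat_inverse (X\<^sup>T * X)) * X\<^sup>T * (W * W\<^sup>T) * X"
    and "R = R\<^sub>1 @\<^sub>c R\<^sub>2"
    and "q = k - vec_space.rank k R"
    and "orthonormal_kernel_basis k q R\<^sup>T Q"
  shows "(vec_space.col_space (n + k) (((W + W\<^sup>T) * X) @\<^sub>r 0\<^sub>m k k)
            \<subseteq> vec_space.col_space (n + k) (X @\<^sub>r K) \<and>
          vec_space.col_space (n + k) ((W * W\<^sup>T * X) @\<^sub>r 0\<^sub>m k k)
            \<subseteq> vec_space.col_space (n + k) (X @\<^sub>r K))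
         \<longleftrightarrow> (\<exists>H. sym_psd_mat q H \<and> K = Q * H * Q\<^sup>T)"
proof -
  have X: "X \<in> carrier_mat n k" and Kc: "K \<in> carrier_mat k k" and Ksym: "K\<^sup>T = K"
    and W: "W \<in> carrier_mat n n"
    using assms by (auto simp: sym_psd_mat_def row_standardized_def)
  define L where "L = the (mat_inverse (X\<^sup>T * X)) * X\<^sup>T"
  have L: "L \<in> carrier_mat k n" and LX: "L * X = 1\<^sub>m k"
    unfolding L_def using full_rank_left_inverse[OF X] assms(4) by auto
  have step: "vec_space.col_space (n + k) (S * X @\<^sub>r 0\<^sub>m k k) \<subseteq> vec_space.col_space (n + k) (X @\<^sub>r K)
      \<longleftrightarrow> (L * S * X)\<^sup>T * K = 0\<^sub>m k k"
    if S: "S \<in> carrier_mat n n"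
      and inv: "vec_space.col_space n (S * X) \<subseteq> vec_space.col_space n X" for S
  proof -
    have SX: "S * X \<in> carrier_mat n k"
      using S X by auto
    have M: "L * S * X \<in> carrier_mat k k"
      using L S X by auto
    have "S * X = X * (L * S * X)"
      using factor_eq_left_inverse_mult[OF X SX L LX inv] assoc_mult_mat[OF L S X] by simp
    then have "vec_space.col_space (n + k) (S * X @\<^sub>r 0\<^sub>m k k) \<subseteq> vec_space.col_space (n + k) (X @\<^sub>r K)
      \<longleftrightarrow> K * (L * S * X) = 0\<^sub>m k k"
      using stacked_col_space_subset_iff[OF X Kc M L LX] by simp
    also have "\<dots> \<longleftrightarrow> (K * (L * S * X))\<^sup>T = 0\<^sub>m k k"
      by (metis transpose_transpose zero_transpose_mat)
    also have "(K * (L * S * X))\<^sup>T = (L * S * X)\<^sup>T * K"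
      using transpose_mult[OF Kc M] Ksym by simp
    finally show ?thesis .
  qed
  have R1_eq: "R\<^sub>1 = L * (W + W\<^sup>T) * X" and R2_eq: "R\<^sub>2 = L * (W * W\<^sup>T) * X"
    using assms(9,10) by (simp_all add: L_def)
  have R1: "R\<^sub>1 \<in> carrier_mat k k" and R2: "R\<^sub>2 \<in> carrier_mat k k"
    unfolding R1_eq R2_eq using L X W by auto
  have Rt: "R\<^sup>T = R\<^sub>1\<^sup>T @\<^sub>r R\<^sub>2\<^sup>T"
    using transpose_append_cols[OF R1 R2] assms(11) by simp
  have Rtc: "R\<^sup>T \<in> carrier_mat (k + k) k"
    unfolding Rt using R1 R2 by auto
  have "R\<^sub>1\<^sup>T * K = 0\<^sub>m k k \<and> R\<^sub>2\<^sup>T * K = 0\<^sub>m k k \<longleftrightarrow> R\<^sup>T * K = 0\<^sub>m k k @\<^sub>r 0\<^sub>m k k"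
    unfolding Rt using R1 R2 Kc
    by (subst append_rows_mult[OF _ _ Kc], (simp; fail), (simp; fail))
      (intro append_rows_eq_iff[symmetric], auto)
  also have "0\<^sub>m k k @\<^sub>r 0\<^sub>m k k = 0\<^sub>m (k + k) k"
    by (intro eq_matI) (auto simp: append_rows_def)
  also have "R\<^sup>T * K = 0\<^sub>m (k + k) k \<longleftrightarrow> (\<exists>H. sym_psd_mat q H \<and> K = Q * H * Q\<^sup>T)"
    by (rule sym_psd_kernel_iff_compression[OF Rtc assms(13) assms(5)])
  finally show ?thesis
    using step[of "W + W\<^sup>T"] step[of "W * W\<^sup>T"] W assms(7,8) by (simp add: R1_eq R2_eq)
qed

end
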